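(* Let $\mathbb{K}=\mathbb{R}$ or $\mathbb{C}$, let $E$ and $F$ be $\mathbb{K}$-Banach spaces, let $p\in\mathbb{N}$, let $n\ge 1$ be an integer, and let $\Omega\subset\mathbb{R}^p$ (nonempty) and $\Omega'\subset\mathbb{R}^p$ be open. Let the pair of spaces $A^n(\Omega,E)$, $A^n(\Omega',F)$ be given by either Situation 1 or Situation 2 described in the context. Assume that $A^n(\Omega,E)$ and $A^n(\Omega',F)$ are endowed with any topologies which are compatible with the pointwise convergence. Suppose that $T:A^n(\Omega,E)\to A^n(\Omega',F)$ is a $\mathbb{K}$-linear biseparating map. Then $T$ is continuous.
   Context: Spaces of differentiable functions. $C^n(\Omega,E)$ is the space of functions $f:\Omega\to E$ whose partial derivatives $\partial^\lambda f$ (with respect to the real variables, $E$ being viewed as a real Banach space) exist and are continuous for every multi-index $\lambda\in(\mathbb{N}\cup\{0\})^p$ with $|\lambda|=\lambda_1+\dots+\lambda_p\le n$; $C^n(\Omega',F)$ is defined likewise. The spaces $A^n(\Omega,E)$ and $A^n(\Omega',F)$ are defined according to one of the following two situations. Situation 1: $\Omega$, $\Omega'$ are (not necessarily bounded) open sets, $A^n(\Omega,E)=C^n(\Omega,E)$ and $A^n(\Omega',F)=C^n(\Omega',F)$. Situation 2: $\Omega$, $\Omega'$ are bounded open sets, $A^n(\Omega,E)=C^n(\bar\Omega,E)$ and $A^n(\Omega',F)=C^n(\bar\Omega',F)$, where $C^n(\bar\Omega,E)$ (resp. $C^n(\bar\Omega',F)$) is the subspace of those functions in $C^n(\Omega,E)$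 (resp. $C^n(\Omega',F)$) whose partial derivatives up to order $n$ admit continuous extension to the boundary of $\Omega$ (resp. $\Omega'$). Biseparating maps. For $f$ in one of these spaces, $c(f)$ denotes the set of points of the open domain ($\Omega$ or $\Omega'$) at which $f\neq 0$. A map $T:A^n(\Omega,E)\to A^n(\Omega',F)$ is separating if it is additive and $c(Tf)\cap c(Tg)=\emptyset$ whenever $c(f)\cap c(g)=\emptyset$; it is biseparating if it is bijective and both $T$ and $T^{-1}$ are separating. Compatible topologies. A locally convex topology on $A^n(\Omega,E)$ is compatible with the pointwise convergence if (1) endowed with it, $A^n(\Omega,E)$ is a Fréchet (or Banach) space, and (2) if $(f_k)$ is a sequence in $A^n(\Omega,E)$ converging to zero in this topology, then $(f_k(x))$ converges to zero in $E$ for every $x\in\Omega$. The same definition applies to $A^n(\Omega',F)$. *)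

theory Defs
  imports "HOL-Analysis.Analysis"
begin

text \<open>
  A Banach space over \<open>K\<close>, where \<open>K\<close> is the real or the complex field, both seen as subsets of the
  complex numbers: the real Banach space structure is that of the type, and \<open>scale\<close> (relevant on \<open>K\<close>
  only) extends the real scalar multiplication to \<open>K\<close>.
\<close>

locale K_banach_space =
  fixes K :: "complex set" and scale :: "complex \<Rightarrow> 'e::banach \<Rightarrow> 'e"
  assumes scalar_field: "K = \<real> \<or> K = UNIV"
    and scale_add_right: "a \<in> K \<Longrightarrow> scale a (x + y) = scale a x + scale a y"
    and scale_add_left: "a \<in> K \<Longrightarrow> b \<in> K \<Longrightarrow> scale (a + b) x = scale a x + scale b x"
    and scale_scale: "a \<in> K \<Longrightarrow> b \<in> K \<Longrightarrow> scale a (scale b x) = scale (a * b) x"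
    and scale_of_real: "scale (of_real r) x = r *\<^sub>R x"
    and norm_scale: "a \<in> K \<Longrightarrow> norm (scale a x) = cmod a * norm x"

definition partial_deriv :: "'p::finite \<Rightarrow> (real^'p \<Rightarrow> 'e::banach) \<Rightarrow> real^'p \<Rightarrow> 'e" where
  "partial_deriv i f x = vector_derivative (\<lambda>t. f (x + t *\<^sub>R axis i 1)) (at 0)"

primrec iter_partial :: "'p::finite list \<Rightarrow> (real^'p \<Rightarrow> 'e::banach) \<Rightarrow> real^'p \<Rightarrow> 'e" where
  "iter_partial [] f = f"
| "iter_partial (i # is) f = partial_deriv i (iter_partial is f)"

primrec iter_partial_exists ::
    "(real^'p) set \<Rightarrow> 'p::finite list \<Rightarrow> (real^'p \<Rightarrow> 'e::banach) \<Rightarrow> bool" where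
  "iter_partial_exists \<Omega> [] f = True"
| "iter_partial_exists \<Omega> (i # is) f =
     (iter_partial_exists \<Omega> is f \<and>
      (\<forall>x\<in>\<Omega>. (\<lambda>t. iter_partial is f (x + t *\<^sub>R axis i 1)) differentiable (at 0)))"

text \<open>
  The orders in which the partial derivatives prescribed by the multi-index \<open>\<alpha>\<close> can be taken. For
  the functions considered here the derivative does not depend on this order, so
  \<open>\<partial>\<^sup>\<alpha> f\<close> is \<open>iter_partial is f\<close> for any \<open>is \<in> orderings \<alpha>\<close>.
\<close>

definition orderings :: "('p::finite \<Rightarrow> nat) \<Rightarrow> 'p list set" where
  "orderings \<alpha> = {is. \<forall>i. count_list is i = \<alpha> i}"

text \<open>
  A function on \<open>\<Omega>\<close> is represented by the function on the whole space that is zero outside \<open>\<Omega>\<close>, so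
  that equality of representations is equality on \<open>\<Omega>\<close>. As \<open>\<Omega>\<close> is open, the derivatives at points
  of \<open>\<Omega>\<close> are not affected.
\<close>

definition C_open :: "nat \<Rightarrow> (real^'p::finite) set \<Rightarrow> (real^'p \<Rightarrow> 'e::banach) set" where
  "C_open n \<Omega> = {f. (\<forall>x. x \<notin> \<Omega> \<longrightarrow> f x = 0) \<and>
     (\<forall>\<alpha>. (\<Sum>i\<in>UNIV. \<alpha> i) \<le> n \<longrightarrow> (\<forall>is\<in>orderings \<alpha>.
        iter_partial_exists \<Omega> is f \<and> continuous_on \<Omega> (iter_partial is f)))}"

text \<open>
  The elements remain functions on \<open>\<Omega>\<close>; the extensions to the boundary are only required to exist.
\<close>

definition C_closure :: "nat \<Rightarrow> (real^'p::finite) set \<Rightarrow> (real^'p \<Rightarrow> 'e::banach) set" where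
  "C_closure n \<Omega> = {f \<in> C_open n \<Omega>.
     \<forall>\<alpha>. (\<Sum>i\<in>UNIV. \<alpha> i) \<le> n \<longrightarrow> (\<forall>is\<in>orderings \<alpha>.
        \<exists>g. continuous_on (closure \<Omega>) g \<and> (\<forall>x\<in>\<Omega>. g x = iter_partial is f x))}"

definition cozero :: "'x set \<Rightarrow> ('x \<Rightarrow> 'e::zero) \<Rightarrow> 'x set" where
  "cozero \<Omega> f = {x \<in> \<Omega>. f x \<noteq> 0}"

definition separating ::
    "'x set \<Rightarrow> ('x \<Rightarrow> 'e::banach) set \<Rightarrow> 'y set \<Rightarrow> ('y \<Rightarrow> 'f::banach) set
      \<Rightarrow> (('x \<Rightarrow> 'e) \<Rightarrow> ('y \<Rightarrow> 'f)) \<Rightarrow> bool" where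
  "separating \<Omega> A \<Omega>' B T \<longleftrightarrow>
     T ` A \<subseteq> B \<and>
     (\<forall>f\<in>A. \<forall>g\<in>A. T (\<lambda>x. f x + g x) = (\<lambda>y. T f y + T g y)) \<and>
     (\<forall>f\<in>A. \<forall>g\<in>A. cozero \<Omega> f \<inter> cozero \<Omega> g = {} \<longrightarrow>
        cozero \<Omega>' (T f) \<inter> cozero \<Omega>' (T g) = {})"

definition biseparating ::
    "'x set \<Rightarrow> ('x \<Rightarrow> 'e::banach) set \<Rightarrow> 'y set \<Rightarrow> ('y \<Rightarrow> 'f::banach) set
      \<Rightarrow> (('x \<Rightarrow> 'e) \<Rightarrow> ('y \<Rightarrow> 'f)) \<Rightarrow> bool" where
  "biseparating \<Omega> A \<Omega>' B T \<longleftrightarrow>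
     bij_betw T A B \<and> separating \<Omega> A \<Omega>' B T \<and> separating \<Omega>' B \<Omega> A (inv_into A T)"

definition K_linear_on ::
    "complex set \<Rightarrow> (complex \<Rightarrow> 'e::banach \<Rightarrow> 'e) \<Rightarrow> (complex \<Rightarrow> 'f::banach \<Rightarrow> 'f)
      \<Rightarrow> ('x \<Rightarrow> 'e) set \<Rightarrow> (('x \<Rightarrow> 'e) \<Rightarrow> ('y \<Rightarrow> 'f)) \<Rightarrow> bool" where
  "K_linear_on K sE sF A T \<longleftrightarrow>
     (\<forall>f\<in>A. \<forall>g\<in>A. T (\<lambda>x. f x + g x) = (\<lambda>y. T f y + T g y)) \<and>
     (\<forall>c\<in>K. \<forall>f\<in>A. T (\<lambda>x. sE c (f x)) = (\<lambda>y. sF c (T f y)))"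

text \<open>
  Topological vector spaces of functions over \<open>K\<close>, with the pointwise operations: the underlying
  space is \<open>topspace X\<close>, and it is closed under the operations because these are continuous
  into \<open>X\<close>.
\<close>

definition topological_function_space ::
    "complex set \<Rightarrow> (complex \<Rightarrow> 'e::banach \<Rightarrow> 'e) \<Rightarrow> ('x \<Rightarrow> 'e) topology \<Rightarrow> bool" where
  "topological_function_space K s X \<longleftrightarrow>
     (\<lambda>x. 0) \<in> topspace X \<and>
     continuous_map (prod_topology X X) X (\<lambda>(f, g). (\<lambda>x. f x + g x)) \<and>
     continuous_map (prod_topology (top_of_set K) X) X (\<lambda>(c, f). (\<lambda>x. s c (f x)))"

definition convex_functions :: "('x \<Rightarrow> 'e::banach) set \<Rightarrow> bool" where
  "convex_functions V \<longleftrightarrow> (\<forall>f\<in>V. \<forall>g\<in>V. \<forall>u v. 0 \<le> u \<and> 0 \<le> v \<and> u + v = 1 \<longrightarrow>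
     (\<lambda>x. u *\<^sub>R f x + v *\<^sub>R g x) \<in> V)"

definition locally_convex ::
    "complex set \<Rightarrow> (complex \<Rightarrow> 'e::banach \<Rightarrow> 'e) \<Rightarrow> ('x \<Rightarrow> 'e) topology \<Rightarrow> bool" where
  "locally_convex K s X \<longleftrightarrow> topological_function_space K s X \<and>
     (\<forall>U. openin X U \<and> (\<lambda>x. 0) \<in> U \<longrightarrow>
        (\<exists>V. openin X V \<and> (\<lambda>x. 0) \<in> V \<and> V \<subseteq> U \<and> convex_functions V))"

text \<open>
  Frechet spaces: locally convex spaces whose topology is induced by a complete
  translation-invariant metric. Banach spaces are a special case.
\<close>

definition frechet ::
    "complex set \<Rightarrow> (complex \<Rightarrow> 'e::banach \<Rightarrow> 'e) \<Rightarrow> ('x \<Rightarrow> 'e) topology \<Rightarrow> bool" where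
  "frechet K s X \<longleftrightarrow> locally_convex K s X \<and>
     (\<exists>d. Metric_space (topspace X) d \<and>
          Metric_space.mtopology (topspace X) d = X \<and>
          Metric_space.mcomplete (topspace X) d \<and>
          (\<forall>f\<in>topspace X. \<forall>g\<in>topspace X. \<forall>h\<in>topspace X.
             d (\<lambda>x. f x + h x) (\<lambda>x. g x + h x) = d f g))"

definition compatible_topology ::
    "complex set \<Rightarrow> (complex \<Rightarrow> 'e::banach \<Rightarrow> 'e) \<Rightarrow> 'x set \<Rightarrow> ('x \<Rightarrow> 'e) set
      \<Rightarrow> ('x \<Rightarrow> 'e) topology \<Rightarrow> bool" where
  "compatible_topology K s \<Omega> A X \<longleftrightarrow>
     topspace X = A \<and> frechet K s X \<and>
     (\<forall>f :: nat \<Rightarrow> 'x \<Rightarrow> 'e. range f \<subseteq> A \<and> limitin X f (\<lambda>x. 0) sequentially \<longrightarrow>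
        (\<forall>x\<in>\<Omega>. (\<lambda>k. f k x) \<longlonglongrightarrow> 0))"

end

theory Submission
  imports Defs "HOL-Library.Function_Algebras"
begin

text \<open>
  The proof combines the closed graph theorem with a gliding hump.

  By the closed graph theorem for F-spaces (\<open>closed_graph\<close>), \<open>T\<close> is continuous as soon as
  \<open>f\<^sub>k \<longlonglongrightarrow> 0\<close> and \<open>T f\<^sub>k \<longlonglongrightarrow> g\<close> force \<open>g = 0\<close>. Suppose that \<open>g \<noteq> 0\<close>. As \<open>g\<close> is continuous, it has no
  zero on some closed ball \<open>V\<close> contained in \<open>\<Omega>'\<close>. Cutting \<open>g\<close> off outside \<open>V\<close> gives a nonzero
  function of the target space, hence a nonzero preimage \<open>f\<^sub>0\<close> under \<open>T\<close>. Infinitely many disjoint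
  balls \<open>B\<^sub>j\<close> fit into the set where \<open>f\<^sub>0 \<noteq> 0\<close>. Because \<open>T\<close> and its inverse both preserve
  disjointness of cozero sets, any ball \<open>B'\<close> in that set has a point \<open>y \<in> V\<close> over it, in the
  sense that \<open>T h y = 0\<close> for every \<open>h\<close> that vanishes on \<open>B'\<close> (\<open>biseparating_point_over_ball\<close>).
  Such points take the place of a homeomorphism between the two domains.

  Let \<open>\<psi>\<^sub>j\<close> be a bump function with support in \<open>B\<^sub>j\<close> that equals \<open>1\<close> on a smaller ball \<open>B'\<^sub>j\<close>, and
  let \<open>y\<^sub>j\<close> be a point over \<open>B'\<^sub>j\<close>. Multiplication by \<open>\<psi>\<^sub>j\<close> is continuous in \<^emph>\<open>any\<close> compatible topology,
  again by the closed graph theorem (\<open>compatible_topology_continuous_multiplier\<close>). Hence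
  \<open>c \<psi>\<^sub>j f\<^sub>k \<longlonglongrightarrow> 0\<close> as \<open>k\<close> grows, for each constant \<open>c\<close>, whereas
  \<open>T (c \<psi>\<^sub>j f\<^sub>k) y\<^sub>j = c T f\<^sub>k y\<^sub>j\<close> tends to \<open>c g y\<^sub>j \<noteq> 0\<close>. Choosing first \<open>c\<close> and then \<open>k\<close> large
  produces \<open>h\<^sub>j\<close> with support in \<open>B\<^sub>j\<close>, at distance at most \<open>2\<^sup>-\<^sup>j\<close> from \<open>0\<close>, with
  \<open>norm (T h\<^sub>j y\<^sub>j) > j\<close>. The series of the \<open>h\<^sub>j\<close> converges to some \<open>s\<close>, which agrees with \<open>h\<^sub>j\<close> on \<open>B\<^sub>j\<close>;
  thus \<open>T s y\<^sub>j = T h\<^sub>j y\<^sub>j\<close> is unbounded in \<open>j\<close>, although \<open>T s\<close> is continuous on the compact set \<open>V\<close>.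
\<close>

section \<open>The closed graph theorem for F-spaces\<close>

text \<open>
  The metric may live on a proper subspace \<open>M\<close> of the type, so that spaces of functions of
  prescribed regularity are covered. Continuity of scalar multiplication is stated separately in
  the vector and, along the sequence \<open>1 / k\<close>, in the scalar: this is the form in which the Baire
  category argument meets it.
\<close>

locale F_space = vector_space scale + Metric_space M d
  for scale :: "real \<Rightarrow> 'a::ab_group_add \<Rightarrow> 'a" and M :: "'a set" and d :: "'a \<Rightarrow> 'a \<Rightarrow> real" +
  assumes subspace_M: "subspace M"
    and complete: "mcomplete"
    and translation: "\<lbrakk>f \<in> M; g \<in> M; h \<in> M\<rbrakk> \<Longrightarrow> d (f + h) (g + h) = d f g"
    and continuous_scale: "continuous_map mtopology mtopology (scale c)"
    and scale_tendsto_0: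
      "f \<in> M \<Longrightarrow> limitin mtopology (\<lambda>k. scale (1 / real (Suc k)) f) 0 sequentially"
begin

lemma zero_in [simp]: "0 \<in> M"
  and add_in [simp]: "f \<in> M \<Longrightarrow> g \<in> M \<Longrightarrow> f + g \<in> M"
  and diff_in [simp]: "f \<in> M \<Longrightarrow> g \<in> M \<Longrightarrow> f - g \<in> M"
  and minus_in [simp]: "f \<in> M \<Longrightarrow> - f \<in> M"
  and scale_in [simp]: "f \<in> M \<Longrightarrow> scale c f \<in> M"
  and sum_in [simp]: "(\<And>k. k \<in> I \<Longrightarrow> F k \<in> M) \<Longrightarrow> sum F I \<in> M"
  using subspace_M
  by (auto intro: subspace_0 subspace_add subspace_diff subspace_neg subspace_scale subspace_sum)

lemma dist_eq_dist_0:
  assumes "f \<in> M" "g \<in> M" shows "d f g = d (f - g) 0"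
  using translation[of "f - g" 0 g] assms by simp

lemma dist_minus_0: assumes "f \<in> M" shows "d (- f) 0 = d f 0"
  using translation[of "- f" 0 f] assms by (simp add: commute)

lemma dist_add_0_le: assumes "f \<in> M" "g \<in> M" shows "d (f + g) 0 \<le> d f 0 + d g 0"
  using triangle[of "f + g" g 0] translation[of f 0 g] assms by simp

lemma dist_diff_0_le: assumes "f \<in> M" "g \<in> M" shows "d (f - g) 0 \<le> d f 0 + d g 0"
  using dist_add_0_le[of f "- g"] dist_minus_0[of g] assms by simp

lemma limitin_diff_0:
  assumes "limitin mtopology F f sequentially" "\<And>k. F k \<in> M"
  shows "limitin mtopology (\<lambda>k. F k - f) 0 sequentially"
  using assms unfolding limit_metric_sequentially by (auto simp: dist_eq_dist_0[of _ f])

lemma scale_continuous_0: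
  assumes "\<epsilon> > 0"
  obtains \<delta> where "\<delta> > 0" "\<And>f. f \<in> M \<Longrightarrow> d f 0 < \<delta> \<Longrightarrow> d (scale c f) 0 < \<epsilon>"
proof -
  have "openin mtopology {f \<in> M. scale c f \<in> mball 0 \<epsilon>}"
    using openin_continuous_map_preimage[OF continuous_scale[of c] openin_mball[of 0 \<epsilon>]] by simp
  moreover have "0 \<in> {f \<in> M. scale c f \<in> mball 0 \<epsilon>}"
    using assms by simp
  ultimately obtain \<delta> where "\<delta> > 0" "mball 0 \<delta> \<subseteq> {f \<in> M. scale c f \<in> mball 0 \<epsilon>}"
    unfolding openin_mtopology by blast
  then show ?thesis
    using that[of \<delta>] by (auto simp: commute subset_iff)
qed

lemma geometric_series_converges:
  assumes F: "\<And>k. F k \<in> M" and c: "\<And>k. d (F k) 0 \<le> c / 2 ^ k"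
  obtains s where "limitin mtopology (\<lambda>m. \<Sum>k<m. F k) s sequentially" "d s 0 \<le> 2 * c"
proof -
  define S where "S m = (\<Sum>k<m. F k)" for m
  have S: "S m \<in> M" for m
    by (simp add: S_def F)
  have c0: "c \<ge> 0"
    using order_trans[OF nonneg c[of 0]] by simp
  have tail: "d (S (N + j)) (S N) \<le> 2 * c / 2 ^ N - 2 * c / 2 ^ (N + j)" for N j
  proof (induction j)
    case 0 then show ?case using S by simp
  next
    case (Suc j)
    have "d (S (N + Suc j)) (S N) \<le> d (S (N + Suc j)) (S (N + j)) + d (S (N + j)) (S N)"
      using S triangle by blast
    also have "d (S (N + Suc j)) (S (N + j)) = d (F (N + j)) 0"
      by (subst dist_eq_dist_0) (use S F in \<open>simp_all add: S_def\<close>)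
    also have "\<dots> \<le> c / 2 ^ (N + j)"
      by (rule c)
    finally have "d (S (N + Suc j)) (S N) \<le> c / 2 ^ (N + j) + d (S (N + j)) (S N)"
      by simp
    moreover have "2 * c / 2 ^ (N + Suc j) = c / 2 ^ (N + j)"
      and "2 * c / 2 ^ (N + j) = c / 2 ^ (N + j) + c / 2 ^ (N + j)"
      by simp_all
    ultimately show ?case
      using Suc by linarith
  qed
  have tail': "d (S m) (S N) \<le> 2 * c / 2 ^ N" if "N \<le> m" for m N
  proof -
    have "2 * c / 2 ^ m \<ge> 0" using c0 by simp
    then show ?thesis using tail[of N "m - N"] that by simp
  qed
  have "MCauchy S"
    unfolding MCauchy_def
  proof (intro conjI allI impI)
    fix \<epsilon> :: real assume "\<epsilon> > 0"
    have "(\<lambda>N. 4 * c * (1 / 2) ^ N) \<longlonglongrightarrow> 4 * c * 0"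
      by (intro tendsto_intros LIMSEQ_power_zero) auto
    then have "\<forall>\<^sub>F N in sequentially. 4 * c * (1 / 2) ^ N < \<epsilon>"
      using \<open>\<epsilon> > 0\<close> by (intro order_tendstoD(2)) auto
    then obtain N where N: "4 * c * (1 / 2) ^ N < \<epsilon>"
      by (auto simp: eventually_sequentially)
    have "d (S m) (S m') < \<epsilon>" if "N \<le> m" "N \<le> m'" for m m'
    proof -
      have "d (S m) (S m') \<le> d (S m) (S N) + d (S m') (S N)"
        using triangle[of "S m" "S N" "S m'"] S by (simp add: commute)
      also have "\<dots> \<le> 2 * c / 2 ^ N + 2 * c / 2 ^ N"
        by (intro add_mono tail' that)
      also have "\<dots> = 4 * c * (1 / 2) ^ N"
        by (simp add: power_one_over)
      finally show ?thesis using N by simp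
    qed
    then show "\<exists>N. \<forall>m m'. N \<le> m \<longrightarrow> N \<le> m' \<longrightarrow> d (S m) (S m') < \<epsilon>"
      by blast
  qed (use S in auto)
  then obtain s where s: "limitin mtopology S s sequentially"
    using complete unfolding mcomplete_def by blast
  have sM: "s \<in> M"
    using s limitin_mspace by blast
  have "d s 0 \<le> 2 * c"
  proof (rule field_le_epsilon)
    fix \<epsilon> :: real assume "\<epsilon> > 0"
    then obtain m where "d (S m) s < \<epsilon>"
      using s unfolding limit_metric_sequentially by (metis order_refl)
    moreover have "d (S m) 0 \<le> 2 * c"
      using tail'[of 0 m] by (simp add: S_def)
    ultimately show "d s 0 \<le> 2 * c + \<epsilon>"
      using triangle[of s "S m" 0] commute[of s "S m"] S[of m] sM by simp
  qed
  with s show ?thesis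
    using that unfolding S_def by blast
qed

end

text \<open>
  Linearity is required on the subspace \<open>M\<close> only: outside it nothing is known of \<open>T\<close>.
\<close>
locale F_space_linear_map = dom: F_space sX M d + cod: F_space sY N e
  for sX :: "real \<Rightarrow> 'a::ab_group_add \<Rightarrow> 'a" and M :: "'a set" and d :: "'a \<Rightarrow> 'a \<Rightarrow> real"
    and sY :: "real \<Rightarrow> 'b::ab_group_add \<Rightarrow> 'b" and N :: "'b set" and e :: "'b \<Rightarrow> 'b \<Rightarrow> real" +
  fixes T :: "'a \<Rightarrow> 'b"
  assumes T_in [simp]: "f \<in> M \<Longrightarrow> T f \<in> N"
    and T_add: "\<lbrakk>f \<in> M; g \<in> M\<rbrakk> \<Longrightarrow> T (f + g) = T f + T g"
    and T_scale: "f \<in> M \<Longrightarrow> T (sX c f) = sY c (T f)"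
begin

lemma T_0: "T 0 = 0"
  using T_add[of 0 0] by simp

lemma T_diff: "\<lbrakk>f \<in> M; g \<in> M\<rbrakk> \<Longrightarrow> T (f - g) = T f - T g"
  using T_add[of "f - g" g] by simp

text \<open>
  The Baire category half of the closed graph theorem: the preimage \<open>U\<close> of a ball is absorbing, so
  the closed sets \<open>{f. f / k \<in> closure U}\<close> cover the space and one of them has an interior point.
  Differences of points of \<open>closure U\<close> then fill a neighbourhood of \<open>0\<close>.
\<close>
lemma almost_continuous:
  assumes "\<epsilon> > 0"
  shows "\<exists>\<delta>>0. \<forall>f\<in>M. d f 0 < \<delta> \<longrightarrow> (\<forall>\<eta>>0. \<exists>u\<in>M. d (f - u) 0 < \<eta> \<and> e (T u) 0 < \<epsilon>)"
proof -
  define U where "U = {f \<in> M. e (T f) 0 < \<epsilon> / 2}"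
  define C where "C k = {f \<in> M. sX (1 / real (Suc k)) f \<in> dom.mtopology closure_of U}" for k
  have closed: "closedin dom.mtopology (C k)" for k
    unfolding C_def
    using closedin_continuous_map_preimage[OF dom.continuous_scale closedin_closure_of] by simp
  have U_cl: "U \<subseteq> dom.mtopology closure_of U"
    by (rule closure_of_subset) (auto simp: U_def)
  have cover: "M \<subseteq> (\<Union>k. C k)"
  proof
    fix f assume f: "f \<in> M"
    have "0 < \<epsilon> / 2" using assms by simp
    then obtain k where "e (sY (1 / real (Suc k)) (T f)) 0 < \<epsilon> / 2"
      using cod.scale_tendsto_0[OF T_in[OF f]] unfolding cod.limit_metric_sequentially
      by (meson order_refl)
    then have "sX (1 / real (Suc k)) f \<in> U"
      using f by (simp add: U_def T_scale)
    then show "f \<in> (\<Union>k. C k)"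
      using U_cl f by (auto simp: C_def)
  qed
  have "\<exists>k. dom.mtopology interior_of (C k) \<noteq> {}"
  proof (rule ccontr)
    assume "\<nexists>k. dom.mtopology interior_of (C k) \<noteq> {}"
    then have "dom.mtopology interior_of (\<Union>(range C)) = {}"
      by (intro dom.metric_Baire_category_alt dom.complete) (auto simp: closed)
    moreover have "\<Union>(range C) = M"
      using cover by (auto simp: C_def)
    ultimately have "M = {}"
      by (metis dom.topspace_mtopology interior_of_topspace)
    then show False using dom.zero_in by blast
  qed
  then obtain k a r where a: "a \<in> M" "r > 0" "dom.mball a r \<subseteq> C k"
    unfolding dom.metric_interior_of by blast
  obtain \<delta> where \<delta>: "\<delta> > 0" "\<And>f. f \<in> M \<Longrightarrow> d f 0 < \<delta> \<Longrightarrow> d (sX (real (Suc k)) f) 0 < r"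
    using dom.scale_continuous_0[OF \<open>r > 0\<close>] by blast
  define b where "b = sX (1 / real (Suc k)) a"
  have b: "b \<in> dom.mtopology closure_of U" "b \<in> M"
    using a by (auto simp: b_def C_def subset_iff)
  have "\<exists>u\<in>M. d (f - u) 0 < \<eta> \<and> e (T u) 0 < \<epsilon>" if f: "f \<in> M" "d f 0 < \<delta>" and "\<eta> > 0" for f \<eta>
  proof -
    define g where "g = sX (real (Suc k)) f"
    have g: "g \<in> M" "d g 0 < r"
      using \<delta>(2)[OF f] f by (auto simp: g_def)
    have "d a (a + g) < r"
      using dom.dist_eq_dist_0[of "a + g" a] g a by (simp add: dom.commute)
    then have "a + g \<in> C k"
      using a g by auto
    moreover have "sX (1 / real (Suc k)) (a + g) = b + f"
      by (simp add: b_def g_def dom.scale_right_distrib del: of_nat_Suc)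
    ultimately have bf: "b + f \<in> dom.mtopology closure_of U"
      by (simp add: C_def)
    have "\<eta> / 2 > 0" using \<open>\<eta> > 0\<close> by simp
    then have "\<exists>u\<in>U. u \<in> dom.mball (b + f) (\<eta> / 2)" and "\<exists>v\<in>U. v \<in> dom.mball b (\<eta> / 2)"
      using bf b unfolding dom.metric_closure_of by blast+
    then obtain u v where u: "u \<in> U" "d (b + f) u < \<eta> / 2" and v: "v \<in> U" "d b v < \<eta> / 2"
      unfolding dom.in_mball by blast
    have uv: "u \<in> M" "v \<in> M"
      using u v by (auto simp: U_def)
    have "d (f - (u - v)) 0 = d ((b + f - u) - (b - v)) 0"
      by (simp add: algebra_simps)
    also have "\<dots> \<le> d (b + f) u + d b v"
      using dom.dist_diff_0_le[of "b + f - u" "b - v"] uv b f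
        dom.dist_eq_dist_0[of "b + f" u] dom.dist_eq_dist_0[of b v] by simp
    finally have "d (f - (u - v)) 0 < \<eta>"
      using u v by simp
    moreover have "e (T (u - v)) 0 < \<epsilon>"
      using cod.dist_diff_0_le[of "T u" "T v"] uv u v by (simp add: T_diff U_def)
    ultimately show ?thesis
      using uv by (intro bexI[of _ "u - v"]) auto
  qed
  with \<delta>(1) show ?thesis by blast
qed

text \<open>
  The approximation of \<open>almost_continuous\<close> is iterated: \<open>f\<close> is successively reduced to remainders
  \<open>h j\<close> that tend to \<open>0\<close>, each step being so small under \<open>T\<close> that the images of the steps form a
  convergent series. Closedness of the graph identifies its sum with \<open>T f\<close>. By translation
  invariance it suffices to assume that the graph is closed over the point \<open>0\<close>.
\<close>
theorem closed_graph:
  assumes closed: "\<And>F g. \<lbrakk>\<And>k. F k \<in> M; limitin dom.mtopology F 0 sequentially;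
      limitin cod.mtopology (\<lambda>k. T (F k)) g sequentially\<rbrakk> \<Longrightarrow> g = 0"
  shows "continuous_map dom.mtopology cod.mtopology T"
proof -
  have at_0: "\<exists>\<delta>>0. \<forall>f\<in>M. d f 0 < \<delta> \<longrightarrow> e (T f) 0 < \<epsilon>" if "\<epsilon> > 0" for \<epsilon>
  proof -
    define \<epsilon>' where "\<epsilon>' = \<epsilon> / 4"
    have \<epsilon>': "\<epsilon>' > 0" using that by (simp add: \<epsilon>'_def)
    have "\<forall>j. \<exists>\<delta>>0. \<forall>f\<in>M. d f 0 < \<delta> \<longrightarrow>
        (\<forall>\<eta>>0. \<exists>u\<in>M. d (f - u) 0 < \<eta> \<and> e (T u) 0 < \<epsilon>' / 2 ^ j)"
      using almost_continuous \<epsilon>' by simp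
    then obtain \<delta> where \<delta>: "\<And>j. \<delta> j > 0"
      and approx: "\<And>j f \<eta>. \<lbrakk>f \<in> M; d f 0 < \<delta> j; \<eta> > 0\<rbrakk> \<Longrightarrow>
        \<exists>u\<in>M. d (f - u) 0 < \<eta> \<and> e (T u) 0 < \<epsilon>' / 2 ^ j"
      by metis
    have "e (T f) 0 < \<epsilon>" if f: "f \<in> M" "d f 0 < \<delta> 0" for f
    proof -
      (* the second bound on h forces the remainders to 0; at j = 0 it repeats the first one *)
      define P where "P j h \<longleftrightarrow> h \<in> M \<and> d h 0 < \<delta> j \<and> d h 0 < (if j = 0 then \<delta> 0 else 1 / real j)" for j h
      have "\<exists>h'. P (Suc j) h' \<and> e (T (h - h')) 0 < \<epsilon>' / 2 ^ j" if h: "P j h" for j h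
      proof -
        have "min (\<delta> (Suc j)) (1 / real (Suc j)) > 0"
          using \<delta> by simp
        then obtain u where u: "u \<in> M" "d (h - u) 0 < min (\<delta> (Suc j)) (1 / real (Suc j))"
          "e (T u) 0 < \<epsilon>' / 2 ^ j"
          using approx[of h j "min (\<delta> (Suc j)) (1 / real (Suc j))"] h unfolding P_def by blast
        then show ?thesis
          using h by (intro exI[of _ "h - u"]) (auto simp: P_def)
      qed
      moreover have "P 0 f"
        using f by (simp add: P_def)
      ultimately obtain h where "\<And>j. P j (h j)" and h0: "h 0 = f"
        and step: "\<And>j. e (T (h j - h (Suc j))) 0 < \<epsilon>' / 2 ^ j"
        using dependent_nat_choice[of "\<lambda>j h. P j h \<and> (j = 0 \<longrightarrow> h = f)"
            "\<lambda>j h h'. e (T (h - h')) 0 < \<epsilon>' / 2 ^ j"] by (metis nat.distinct(1))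
      then have h: "\<And>j. h j \<in> M" "\<And>j. d (h (Suc j)) 0 < 1 / real (Suc j)"
        unfolding P_def by (blast, metis nat.distinct(1))
      have partial_sums: "(\<Sum>j<m. T (h j - h (Suc j))) = T f - T (h m)" for m
        by (induction m) (auto simp: h h0 T_diff)
      obtain s where s: "limitin cod.mtopology (\<lambda>m. T f - T (h m)) s sequentially"
          and s_le: "e s 0 \<le> 2 * \<epsilon>'"
        using cod.geometric_series_converges[of "\<lambda>j. T (h j - h (Suc j))" \<epsilon>'] step h
        by (auto simp: partial_sums intro: less_imp_le)
      have sN: "s \<in> N"
        using s cod.limitin_mspace by blast
      have "limitin cod.mtopology (\<lambda>m. T (h m)) (T f - s) sequentially"
        unfolding cod.limit_metric_sequentially
      proof (intro conjI allI impI)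
        fix \<eta> :: real assume "\<eta> > 0"
        then obtain m0 where m0: "\<And>m. m \<ge> m0 \<Longrightarrow> e (T f - T (h m)) s < \<eta>"
          using s unfolding cod.limit_metric_sequentially by blast
        have "e (T (h m)) (T f - s) = e (T f - T (h m)) s" for m
          using cod.dist_eq_dist_0[of "T (h m)" "T f - s"] cod.dist_eq_dist_0[of "T f - T (h m)" s]
            cod.dist_minus_0[of "T (h m) - (T f - s)"] h f sN by (simp add: algebra_simps)
        then show "\<exists>m0. \<forall>m\<ge>m0. T (h m) \<in> N \<and> e (T (h m)) (T f - s) < \<eta>"
          using m0 h by auto
      qed (use f sN in auto)
      moreover have "limitin dom.mtopology h 0 sequentially"
        unfolding dom.limit_metric_sequentially
      proof (intro conjI allI impI)
        fix \<eta> :: real assume "\<eta> > 0"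
        then obtain m0 where m0: "1 / real (Suc m0) < \<eta>"
          using nat_approx_posE by blast
        have "d (h m) 0 < \<eta>" if m: "m \<ge> Suc m0" for m
        proof -
          obtain j where j: "m = Suc j" "m0 \<le> j" using m by (cases m) auto
          then have "1 / real (Suc j) \<le> 1 / real (Suc m0)"
            by (intro divide_left_mono) auto
          then show ?thesis using h(2)[of j] j m0 by simp
        qed
        then show "\<exists>m0. \<forall>m\<ge>m0. h m \<in> M \<and> d (h m) 0 < \<eta>"
          using h by blast
      qed auto
      ultimately have "T f - s = 0"
        using closed h by blast
      then show ?thesis
        using s_le \<epsilon>' by (simp add: \<epsilon>'_def)
    qed
    then show ?thesis
      using \<delta> by blast
  qed
  show ?thesis
    unfolding continuous_map_def
  proof (intro conjI allI impI)
    fix V assume V: "openin cod.mtopology V"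
    show "openin dom.mtopology {f \<in> topspace dom.mtopology. T f \<in> V}"
      unfolding dom.openin_mtopology
    proof (intro conjI allI impI)
      fix f assume "f \<in> {f \<in> topspace dom.mtopology. T f \<in> V}"
      then have f: "f \<in> M" "T f \<in> V" by auto
      then obtain \<epsilon> where \<epsilon>: "\<epsilon> > 0" "cod.mball (T f) \<epsilon> \<subseteq> V"
        using V unfolding cod.openin_mtopology by blast
      obtain \<delta> where \<delta>: "\<delta> > 0" "\<And>g. g \<in> M \<Longrightarrow> d g 0 < \<delta> \<Longrightarrow> e (T g) 0 < \<epsilon>"
        using at_0[OF \<epsilon>(1)] by blast
      have "T g \<in> V" if g: "g \<in> M" "d f g < \<delta>" for g
      proof -
        have "e (T f) (T g) < \<epsilon>"
          using \<delta>(2)[of "f - g"] g f dom.dist_eq_dist_0[of f g] cod.dist_eq_dist_0[of "T f" "T g"]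
          by (simp add: T_diff)
        then show ?thesis using \<epsilon> g f by auto
      qed
      then show "\<exists>r>0. dom.mball f r \<subseteq> {f \<in> topspace dom.mtopology. T f \<in> V}"
        using \<delta>(1) by (intro exI[of _ \<delta>]) auto
    qed auto
  qed auto
qed

end

section \<open>Functions of class \<open>C\<^sup>n\<close> and bump functions\<close>

text \<open>
  With \<open>S = \<Omega>\<close> this is continuity on \<open>\<Omega>\<close>, with \<open>S = closure \<Omega>\<close> it is the existence of a continuous
  extension to the boundary. The parameter \<open>S\<close> allows both kinds of function space to be treated
  at once.
\<close>

definition extends_to :: "'x set \<Rightarrow> 'x set \<Rightarrow> ('x::topological_space \<Rightarrow> 'e::topological_space) \<Rightarrow> bool" where
  "extends_to S \<Omega> f \<longleftrightarrow> (\<exists>h. continuous_on S h \<and> (\<forall>x\<in>\<Omega>. h x = f x))"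

text \<open>
  The recursion is on the derivative taken first, whereas \<^const>\<open>iter_partial\<close> recurses on the
  one taken last. In this form closure properties are proved by induction on the order, since the
  first derivatives of a function of class \<open>C\<^sup>k\<^sup>+\<^sup>1\<close> are themselves of class \<open>C\<^sup>k\<close>.
\<close>
primrec C_upto ::
    "nat \<Rightarrow> (real^'p::finite) set \<Rightarrow> (real^'p) set \<Rightarrow> (real^'p \<Rightarrow> 'e::banach) \<Rightarrow> bool" where
  "C_upto 0 S \<Omega> f \<longleftrightarrow> extends_to S \<Omega> f"
| "C_upto (Suc k) S \<Omega> f \<longleftrightarrow> extends_to S \<Omega> f \<and>
     (\<forall>i. iter_partial_exists \<Omega> [i] f \<and> C_upto k S \<Omega> (partial_deriv i f))"

definition C_space ::
    "nat \<Rightarrow> (real^'p::finite) set \<Rightarrow> (real^'p) set \<Rightarrow> (real^'p \<Rightarrow> 'e::banach) set" where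
  "C_space n S \<Omega> = {f. (\<forall>x. x \<notin> \<Omega> \<longrightarrow> f x = 0) \<and> C_upto n S \<Omega> f}"

lemma extends_to_self: "extends_to \<Omega> \<Omega> f \<longleftrightarrow> continuous_on \<Omega> f"
  unfolding extends_to_def using continuous_on_cong by fastforce

lemma extends_to_imp_continuous:
  "\<lbrakk>extends_to S \<Omega> f; \<Omega> \<subseteq> S\<rbrakk> \<Longrightarrow> continuous_on \<Omega> f"
  unfolding extends_to_def by (metis continuous_on_cong continuous_on_subset)

lemma extends_to_cong: "(\<And>x. x \<in> \<Omega> \<Longrightarrow> f x = g x) \<Longrightarrow> extends_to S \<Omega> f \<longleftrightarrow> extends_to S \<Omega> g"
  unfolding extends_to_def by auto

lemma extends_to_continuous: "continuous_on UNIV f \<Longrightarrow> extends_to S \<Omega> f"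
  unfolding extends_to_def by (intro exI[of _ f]) (auto intro: continuous_on_subset)

lemma extends_to_compose:
  assumes "continuous_on UNIV \<phi>" "extends_to S \<Omega> f"
  shows "extends_to S \<Omega> (\<lambda>x. \<phi> (f x))"
proof -
  obtain h where h: "continuous_on S h" "\<forall>x\<in>\<Omega>. h x = f x"
    using assms(2) unfolding extends_to_def by blast
  have "continuous_on S (\<lambda>x. \<phi> (h x))"
    using continuous_on_compose2[OF assms(1) h(1)] by simp
  then show ?thesis
    unfolding extends_to_def using h(2) by (intro exI[of _ "\<lambda>x. \<phi> (h x)"]) auto
qed

lemma extends_to_Pair:
  assumes "extends_to S \<Omega> f" "extends_to S \<Omega> g"
  shows "extends_to S \<Omega> (\<lambda>x. (f x, g x))"
proof -
  obtain h h' where h: "continuous_on S h" "\<forall>x\<in>\<Omega>. h x = f x"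
    "continuous_on S h'" "\<forall>x\<in>\<Omega>. h' x = g x"
    using assms unfolding extends_to_def by blast
  then show ?thesis
    unfolding extends_to_def by (intro exI[of _ "\<lambda>x. (h x, h' x)"]) (auto intro: continuous_on_Pair)
qed

lemma extends_to_add:
  fixes f g :: "'x::topological_space \<Rightarrow> 'e::topological_monoid_add"
  assumes "extends_to S \<Omega> f" "extends_to S \<Omega> g"
  shows "extends_to S \<Omega> (\<lambda>x. f x + g x)"
proof -
  have "continuous_on UNIV (\<lambda>p::'e \<times> 'e. fst p + snd p)"
    by (intro continuous_intros)
  from extends_to_compose[OF this extends_to_Pair[OF assms]] show ?thesis by simp
qed

lemma extends_to_scaleR:
  fixes f :: "'x::topological_space \<Rightarrow> 'e::real_normed_vector"
  assumes "extends_to S \<Omega> \<phi>" "extends_to S \<Omega> f"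
  shows "extends_to S \<Omega> (\<lambda>x. \<phi> x *\<^sub>R f x)"
proof -
  have "continuous_on UNIV (\<lambda>p::real \<times> 'e. fst p *\<^sub>R snd p)"
    by (intro continuous_intros)
  from extends_to_compose[OF this extends_to_Pair[OF assms]] show ?thesis by simp
qed

lemma iter_partial_snoc: "iter_partial (is @ [j]) f = iter_partial is (partial_deriv j f)"
  by (induction "is") auto

lemma iter_partial_exists_snoc:
  "iter_partial_exists \<Omega> (is @ [j]) f \<longleftrightarrow>
     iter_partial_exists \<Omega> [j] f \<and> iter_partial_exists \<Omega> is (partial_deriv j f)"
  by (induction "is") (auto simp: iter_partial_snoc)

lemma C_upto_iff_iter_partial:
  "C_upto k S \<Omega> f \<longleftrightarrow>
     (\<forall>is. length is \<le> k \<longrightarrow> iter_partial_exists \<Omega> is f \<and> extends_to S \<Omega> (iter_partial is f))"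
proof (induction k arbitrary: f)
  case 0
  show ?case by auto
next
  case (Suc k)
  let ?P = "\<lambda>is f. iter_partial_exists \<Omega> is f \<and> extends_to S \<Omega> (iter_partial is f)"
  have "(\<forall>is. length is \<le> Suc k \<longrightarrow> ?P is f) \<longleftrightarrow>
      ?P [] f \<and> (\<forall>is j. length is \<le> k \<longrightarrow> ?P (is @ [j]) f)"
    by (metis Suc_le_mono le0 length_append_singleton list.size(3) rev_exhaust)
  also have "\<dots> \<longleftrightarrow> extends_to S \<Omega> f \<and> (\<forall>j. iter_partial_exists \<Omega> [j] f \<and> C_upto k S \<Omega> (partial_deriv j f))"
    unfolding Suc iter_partial_snoc iter_partial_exists_snoc
    by (metis iter_partial.simps(1) iter_partial_exists.simps(1) le0 list.size(3))
  finally show ?case by simp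
qed

text \<open>
  Quantifying over multi-indices of size at most \<open>n\<close> and then over their orderings is quantifying
  over all lists of length at most \<open>n\<close>: a list is an ordering of exactly one multi-index.
\<close>
lemma orderings_le_iff:
  "(\<forall>\<alpha>. (\<Sum>i\<in>UNIV. \<alpha> i) \<le> n \<longrightarrow> (\<forall>is\<in>orderings \<alpha>. P is)) \<longleftrightarrow>
   (\<forall>is::'p::finite list. length is \<le> n \<longrightarrow> P is)"
proof -
  have "(is \<in> orderings \<alpha>) = ( \<alpha> = count_list is)" for \<alpha> and "is" :: "'p list"
    by (auto simp: orderings_def)
  note this [simp]
  have "(\<Sum>i\<in>UNIV. count_list is i) = length is" for "is" :: "'p list"
    by (rule sum_count_set) auto
  then show ?thesis by (simp add: Ball_def) metis
qed

lemma C_open_eq: "C_open n \<Omega> = C_space n \<Omega> \<Omega>"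
  unfolding C_open_def C_space_def C_upto_iff_iter_partial orderings_le_iff extends_to_self ..

lemma C_closure_eq:
  "(C_closure n \<Omega> :: (real^'p::finite \<Rightarrow> 'e::banach) set) = C_space n (closure \<Omega>) \<Omega>"
proof (rule set_eqI)
  fix f :: "real^'p \<Rightarrow> 'e"
  define ex where "ex is \<longleftrightarrow> iter_partial_exists \<Omega> is f" for "is"
  define cont where "cont is \<longleftrightarrow> continuous_on \<Omega> (iter_partial is f)" for "is"
  define ext where "ext is \<longleftrightarrow> extends_to (closure \<Omega>) \<Omega> (iter_partial is f)" for "is"
  have "ext is \<Longrightarrow> cont is" for "is"
    unfolding ext_def cont_def using extends_to_imp_continuous[OF _ closure_subset] .
  then have *: "((\<forall>is. length is \<le> n \<longrightarrow> ex is \<and> cont is) \<and> (\<forall>is. length is \<le> n \<longrightarrow> ext is)) =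
      (\<forall>is. length is \<le> n \<longrightarrow> ex is \<and> ext is)"
    by blast
  show "(f \<in> C_closure n \<Omega>) = (f \<in> C_space n (closure \<Omega>) \<Omega>)"
    unfolding C_closure_def C_open_def C_space_def C_upto_iff_iter_partial orderings_le_iff
      mem_Collect_eq conj_assoc *[unfolded ex_def cont_def ext_def, symmetric]
    unfolding extends_to_def by (rule refl)
qed

abbreviation has_partial ::
    "(real^'p::finite \<Rightarrow> 'e::banach) \<Rightarrow> 'p \<Rightarrow> real^'p \<Rightarrow> 'e \<Rightarrow> bool" where
  "has_partial f i x D \<equiv> ((\<lambda>t. f (x + t *\<^sub>R axis i 1)) has_vector_derivative D) (at 0)"

lemma has_partial_cong:
  assumes "open \<Omega>" "x \<in> \<Omega>" "\<And>y. y \<in> \<Omega> \<Longrightarrow> f y = g y" "has_partial f i x D"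
  shows "has_partial g i x D"
proof (rule has_vector_derivative_transform_within_open[OF assms(4)])
  show "open ((\<lambda>t. x + t *\<^sub>R axis i 1) -` \<Omega>)"
    by (intro open_vimage assms(1) continuous_intros)
  show "0 \<in> (\<lambda>t. x + t *\<^sub>R axis i 1) -` \<Omega>"
    using assms(2) by simp
  show "f (x + t *\<^sub>R axis i 1) = g (x + t *\<^sub>R axis i 1)"
    if "t \<in> (\<lambda>t. x + t *\<^sub>R axis i 1) -` \<Omega>" for t
    using that by (intro assms(3)) simp
qed

lemma partial_deriv_eqI: "has_partial f i x D \<Longrightarrow> partial_deriv i f x = D"
  unfolding partial_deriv_def by (rule vector_derivative_at)

lemma iter_partial_exists_singleton:
  "iter_partial_exists \<Omega> [i] f \<longleftrightarrow> (\<forall>x\<in>\<Omega>. has_partial f i x (partial_deriv i f x))"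
  by (simp only: partial_deriv_def iter_partial_exists.simps iter_partial.simps
      vector_derivative_works simp_thms)

lemma C_upto_Suc_has_partial:
  "\<lbrakk>C_upto (Suc k) S \<Omega> f; x \<in> \<Omega>\<rbrakk> \<Longrightarrow> has_partial f i x (partial_deriv i f x)"
  unfolding C_upto.simps(2) iter_partial_exists_singleton by (elim conjE allE[of _ i] bspec)

lemma C_upto_Suc_partial_deriv: "C_upto (Suc k) S \<Omega> f \<Longrightarrow> C_upto k S \<Omega> (partial_deriv i f)"
  by simp

lemma C_upto_extends: "C_upto k S \<Omega> f \<Longrightarrow> extends_to S \<Omega> f"
  by (cases k) simp_all

lemma C_upto_SucI_partial_deriv:
  assumes "extends_to S \<Omega> f"
    and "\<And>i x. x \<in> \<Omega> \<Longrightarrow> has_partial f i x (partial_deriv i f x)"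
    and "\<And>i. C_upto k S \<Omega> (partial_deriv i f)"
  shows "C_upto (Suc k) S \<Omega> f"
  unfolding C_upto.simps(2) iter_partial_exists_singleton
  by (intro conjI allI ballI) (fact assms)+

lemma C_upto_cong:
  assumes "open \<Omega>" "\<And>x. x \<in> \<Omega> \<Longrightarrow> f x = g x" "C_upto k S \<Omega> f"
  shows "C_upto k S \<Omega> g"
  using assms(2,3)
proof (induction k arbitrary: f g)
  case 0
  then show ?case
    using extends_to_cong[of \<Omega> f g S] by simp
next
  case (Suc k)
  have D: "has_partial g i x (partial_deriv i f x)" if "x \<in> \<Omega>" for i x
    using has_partial_cong[OF assms(1) that Suc.prems(1) C_upto_Suc_has_partial[OF Suc.prems(2) that]] .
  have eq: "partial_deriv i g x = partial_deriv i f x" if "x \<in> \<Omega>" for i x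
    using partial_deriv_eqI[OF D[OF that]] .
  show ?case
  proof (rule C_upto_SucI_partial_deriv)
    show "extends_to S \<Omega> g"
      using extends_to_cong[of \<Omega> f g S] Suc.prems(1) C_upto_extends[OF Suc.prems(2)] by blast
    show "has_partial g i x (partial_deriv i g x)" if "x \<in> \<Omega>" for i x
      unfolding eq[OF that] using D[OF that] .
    show "C_upto k S \<Omega> (partial_deriv i g)" for i
      using Suc.IH[OF eq[symmetric] C_upto_Suc_partial_deriv[OF Suc.prems(2)]] .
  qed
qed

lemma C_upto_SucI:
  assumes "open \<Omega>" "extends_to S \<Omega> f" "\<And>i x. x \<in> \<Omega> \<Longrightarrow> has_partial f i x (f' i x)"
    and "\<And>i. C_upto k S \<Omega> (f' i)"
  shows "C_upto (Suc k) S \<Omega> f"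
proof (rule C_upto_SucI_partial_deriv)
  have eq: "partial_deriv i f x = f' i x" if "x \<in> \<Omega>" for i x
    using partial_deriv_eqI[OF assms(3)[OF that]] .
  show "has_partial f i x (partial_deriv i f x)" if "x \<in> \<Omega>" for i x
    unfolding eq[OF that] using assms(3)[OF that] .
  show "C_upto k S \<Omega> (partial_deriv i f)" for i
    using C_upto_cong[OF assms(1) eq[of _ i, symmetric] assms(4)[of i]] .
qed (rule assms(2))

lemma C_upto_Suc_D: "C_upto (Suc k) S \<Omega> f \<Longrightarrow> C_upto k S \<Omega> f"
proof (induction k arbitrary: f)
  case 0
  then show ?case by simp
next
  case (Suc k)
  show ?case
    by (rule C_upto_SucI_partial_deriv)
      (rule C_upto_extends[OF Suc.prems] C_upto_Suc_has_partial[OF Suc.prems]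
        Suc.IH[OF C_upto_Suc_partial_deriv[OF Suc.prems]] | assumption)+
qed

lemma C_upto_const: "open \<Omega> \<Longrightarrow> C_upto k S \<Omega> (\<lambda>x. c)"
proof (induction k arbitrary: c)
  case 0
  show ?case by (simp add: extends_to_continuous)
next
  case (Suc k)
  show ?case
    by (rule C_upto_SucI[where f' = "\<lambda>i x. 0"]) (simp_all add: Suc extends_to_continuous)
qed

lemma C_upto_coordinate: "open (\<Omega> :: (real^'a::finite) set) \<Longrightarrow> C_upto k S \<Omega> (\<lambda>x. x $ j)"
proof (cases k)
  case 0
  then show ?thesis by (simp add: extends_to_continuous continuous_on_component)
next
  case (Suc k')
  assume "open \<Omega>"
  then show ?thesis unfolding Suc
  proof (rule C_upto_SucI[where f' = "\<lambda>i x. axis i 1 $ j"])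
    show "has_partial (\<lambda>x. x $ j) i x (axis i 1 $ j)" for i and x :: "real^'a"
      unfolding vector_add_component vector_scaleR_component
        has_real_derivative_iff_has_vector_derivative[symmetric]
      by (auto intro!: derivative_eq_intros)
  qed (simp_all add: C_upto_const extends_to_continuous continuous_on_component \<open>open \<Omega>\<close>)
qed

lemma C_upto_add:
  assumes "open \<Omega>"
  shows "C_upto k S \<Omega> f \<Longrightarrow> C_upto k S \<Omega> g \<Longrightarrow> C_upto k S \<Omega> (\<lambda>x. f x + g x)"
proof (induction k arbitrary: f g)
  case 0
  then show ?case by (simp add: extends_to_add)
next
  case (Suc k)
  show ?case
  proof (rule C_upto_SucI[where f' = "\<lambda>i x. partial_deriv i f x + partial_deriv i g x"])
    show "has_partial (\<lambda>x. f x + g x) i x (partial_deriv i f x + partial_deriv i g x)"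
      if "x \<in> \<Omega>" for i x
      using C_upto_Suc_has_partial[OF Suc.prems(1) that] C_upto_Suc_has_partial[OF Suc.prems(2) that]
      by (rule has_vector_derivative_add)
    show "C_upto k S \<Omega> (\<lambda>x. partial_deriv i f x + partial_deriv i g x)" for i
      using Suc.IH[OF Suc.prems(1)[THEN C_upto_Suc_partial_deriv] Suc.prems(2)[THEN C_upto_Suc_partial_deriv]] .
    show "extends_to S \<Omega> (\<lambda>x. f x + g x)"
      using extends_to_add[OF Suc.prems(1)[THEN C_upto_extends] Suc.prems(2)[THEN C_upto_extends]] .
  qed (rule assms)
qed

lemma C_upto_scaleR:
  fixes f :: "real^'p::finite \<Rightarrow> 'e::banach"
  assumes "open \<Omega>"
  shows "C_upto k S \<Omega> \<phi> \<Longrightarrow> C_upto k S \<Omega> f \<Longrightarrow> C_upto k S \<Omega> (\<lambda>x. \<phi> x *\<^sub>R f x)"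
proof (induction k arbitrary: \<phi> f)
  case 0
  then show ?case by (simp add: extends_to_scaleR)
next
  case (Suc k)
  show ?case
  proof (rule C_upto_SucI[where f' = "\<lambda>i x. \<phi> x *\<^sub>R partial_deriv i f x + partial_deriv i \<phi> x *\<^sub>R f x"])
    show "has_partial (\<lambda>x. \<phi> x *\<^sub>R f x) i x
        (\<phi> x *\<^sub>R partial_deriv i f x + partial_deriv i \<phi> x *\<^sub>R f x)" if "x \<in> \<Omega>" for i x
      using has_vector_derivative_scaleR[OF
          has_real_derivative_iff_has_vector_derivative[THEN iffD2, OF C_upto_Suc_has_partial[OF Suc.prems(1) that]]
          C_upto_Suc_has_partial[OF Suc.prems(2) that], of i i]
      by simp
    show "C_upto k S \<Omega> (\<lambda>x. \<phi> x *\<^sub>R partial_deriv i f x + partial_deriv i \<phi> x *\<^sub>R f x)" for i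
      using Suc.IH[OF Suc.prems(1)[THEN C_upto_Suc_D] Suc.prems(2)[THEN C_upto_Suc_partial_deriv]]
        Suc.IH[OF Suc.prems(1)[THEN C_upto_Suc_partial_deriv] Suc.prems(2)[THEN C_upto_Suc_D]]
      by (rule C_upto_add[OF assms])
    show "extends_to S \<Omega> (\<lambda>x. \<phi> x *\<^sub>R f x)"
      by (intro extends_to_scaleR C_upto_extends[OF Suc.prems(1)] C_upto_extends[OF Suc.prems(2)])
  qed (rule assms)
qed

lemma C_upto_sum:
  assumes "open \<Omega>" "\<And>j. j \<in> I \<Longrightarrow> C_upto k S \<Omega> (f j)"
  shows "C_upto k S \<Omega> (\<lambda>x. \<Sum>j\<in>I. f j x)"
  using assms(2)
proof (induction I rule: infinite_finite_induct)
  case (insert j I)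
  have "C_upto k S \<Omega> (\<lambda>x. f j x + (\<Sum>j\<in>I. f j x))"
    by (rule C_upto_add[OF assms(1)]) (simp_all add: insert)
  then show ?case
    using insert(1,2) by simp
qed (simp_all add: C_upto_const assms(1))

text \<open>
  Powers of the positive part supply all bump functions: the power \<open>m\<close> is of class \<open>C\<^sup>k\<close> for each
  \<open>k < m\<close>, with a derivative of the same shape, so an induction on \<open>k\<close> suffices.
\<close>
lemma DERIV_pos_part_power:
  assumes "m > 0"
  shows "((\<lambda>t::real. max 0 t ^ Suc m) has_real_derivative real (Suc m) * max 0 t ^ m) (at t)"
proof -
  consider "t > 0" | "t < 0" | "t = 0" by linarith
  then show ?thesis
  proof cases
    case 1
    have "((\<lambda>t::real. t ^ Suc m) has_real_derivative real (Suc m) * max 0 t ^ m) (at t)"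
      using DERIV_pow[of "Suc m" t] 1 by simp
    then show ?thesis
      by (rule has_field_derivative_transform_within_open[where S = "{0<..}"]) (use 1 in simp_all)
  next
    case 2
    have "((\<lambda>t::real. 0) has_real_derivative real (Suc m) * max 0 t ^ m) (at t)"
      using 2 assms by (simp add: power_0_left)
    then show ?thesis
      by (rule has_field_derivative_transform_within_open[where S = "{..<0}"]) (use 2 in simp_all)
  next
    case 3
    have "(\<lambda>h::real. max 0 h ^ m) \<midarrow>0\<rightarrow> max 0 0 ^ m"
      by (intro tendsto_intros)
    moreover have "max 0 h ^ m = (max 0 (0 + h) ^ Suc m - max 0 0 ^ Suc m) / h" if "h \<noteq> 0" for h :: real
      using that assms by (cases "h > 0") simp_all
    then have "\<forall>\<^sub>F h :: real in at 0. max 0 h ^ m = (max 0 (0 + h) ^ Suc m - max 0 0 ^ Suc m) / h"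
      unfolding eventually_at_filter by (intro always_eventually) blast
    ultimately have "(\<lambda>h::real. (max 0 (0 + h) ^ Suc m - max 0 0 ^ Suc m) / h) \<midarrow>0\<rightarrow> max 0 0 ^ m"
      by (rule Lim_transform_eventually)
    moreover have "real (Suc m) * max 0 0 ^ m = max (0::real) 0 ^ m"
      using assms by (simp add: power_0_left)
    ultimately show ?thesis
      unfolding DERIV_def 3 by (simp only:)
  qed
qed

lemma extends_to_pos_part_power:
  "extends_to S \<Omega> u \<Longrightarrow> extends_to S \<Omega> (\<lambda>x. max 0 (u x :: real) ^ m)"
  by (rule extends_to_compose) (intro continuous_intros)

lemma C_upto_pos_part_power:
  assumes "open \<Omega>"
  shows "\<lbrakk>C_upto k S \<Omega> u; k < m\<rbrakk> \<Longrightarrow> C_upto k S \<Omega> (\<lambda>x. max 0 (u x :: real) ^ m)"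
proof (induction k arbitrary: u m)
  case 0
  then show ?case
    by (simp add: extends_to_pos_part_power)
next
  case (Suc k)
  then obtain m' where m: "m = Suc m'" "k < m'"
    by (cases m) auto
  let ?f' = "\<lambda>i x. (real m *\<^sub>R (max 0 (u x) ^ m')) *\<^sub>R partial_deriv i u x"
  show ?case
  proof (rule C_upto_SucI[where f' = ?f'])
    show "has_partial (\<lambda>x. max 0 (u x) ^ m) i x (?f' i x)" if "x \<in> \<Omega>" for i x
      using DERIV_chain2[OF DERIV_pos_part_power
          has_real_derivative_iff_has_vector_derivative[THEN iffD2, OF C_upto_Suc_has_partial[OF Suc.prems(1) that]],
          of m' i]
        m unfolding has_real_derivative_iff_has_vector_derivative by simp
    show "C_upto k S \<Omega> (?f' i)" for i
      by (rule C_upto_scaleR[OF assms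
            C_upto_scaleR[OF assms C_upto_const[OF assms] Suc.IH[OF Suc.prems(1)[THEN C_upto_Suc_D] m(2)]]
            Suc.prems(1)[THEN C_upto_Suc_partial_deriv]])
    show "extends_to S \<Omega> (\<lambda>x. max 0 (u x) ^ m)"
      by (intro extends_to_pos_part_power C_upto_extends[OF Suc.prems(1)])
  qed (rule assms)
qed

text \<open>
  Bumps of class \<open>C\<^sup>n\<close> are enough, and these are obtained from \<open>p t = max 0 t ^ (n + 1)\<close>. The
  function \<open>q x = p (r\<^sup>2 - (dist a x)\<^sup>2)\<close> is supported in the ball of radius \<open>r\<close>, but it is not constant
  near the centre. The function \<open>1 - p (1 - c q)\<close> has the zeros of \<open>q\<close> and equals \<open>1\<close> wherever
  \<open>c q \<ge> 1\<close>, since \<open>p 1 = 1\<close> and \<open>p\<close> vanishes on negative numbers.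
\<close>
lemma bump_function:
  fixes a :: "real^'p::finite"
  assumes "r > 0"
  obtains \<psi> :: "real^'p \<Rightarrow> real" and r' where "r' > 0"
    and "\<And>\<Omega> S. open \<Omega> \<Longrightarrow> C_upto n S \<Omega> \<psi>"
    and "\<And>x. dist a x < r' \<Longrightarrow> \<psi> x = 1" and "\<And>x. r \<le> dist a x \<Longrightarrow> \<psi> x = 0"
proof -
  define q where "q x = max 0 (r\<^sup>2 - (dist a x)\<^sup>2) ^ Suc n" for x
  (* c q reaches 1 where the squared distance to a is at most half of the squared radius *)
  define c where "c = 1 / (r\<^sup>2 / 2) ^ Suc n"
  define \<psi> where "\<psi> x = 1 + (- 1) *\<^sub>R max 0 (1 + (- c) *\<^sub>R q x) ^ Suc n" for x
  have dist_sq: "(dist a x)\<^sup>2 = (\<Sum>j\<in>UNIV. (a $ j + (- 1) *\<^sub>R x $ j) *\<^sub>R (a $ j + (- 1) *\<^sub>R x $ j))" for x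
    by (simp add: dist_vec_def L2_set_def sum_nonneg dist_real_def power2_eq_square[symmetric])
  have q: "C_upto n S \<Omega> q" if "open \<Omega>" for S \<Omega>
  proof -
    have "C_upto n S \<Omega> (\<lambda>x. max 0 (r\<^sup>2 + (- 1) *\<^sub>R (dist a x)\<^sup>2) ^ Suc n)"
      unfolding dist_sq
      by (intro C_upto_pos_part_power C_upto_add C_upto_scaleR C_upto_sum C_upto_const
          C_upto_coordinate that) simp
    then show ?thesis by (simp add: q_def[abs_def])
  qed
  have "C_upto n S \<Omega> \<psi>" if "open \<Omega>" for S \<Omega>
    unfolding \<psi>_def[abs_def]
    by (intro C_upto_pos_part_power C_upto_add C_upto_scaleR C_upto_const q that) simp
  moreover have "\<psi> x = 1" if "dist a x < r / 2" for x
  proof -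
    have "(dist a x)\<^sup>2 \<le> (r / 2)\<^sup>2"
      using that by (intro power_mono) auto
    then have "r\<^sup>2 / 2 \<le> r\<^sup>2 - (dist a x)\<^sup>2"
      by (simp add: power_divide) (use zero_le_power2[of r] in linarith)
    then have "(r\<^sup>2 / 2) ^ Suc n \<le> q x"
      unfolding q_def by (intro power_mono) (simp_all add: le_max_iff_disj)
    moreover have "(r\<^sup>2 / 2) ^ Suc n > 0"
      using assms by simp
    ultimately have "c * q x \<ge> 1"
      unfolding c_def by (simp add: field_simps)
    then show ?thesis by (simp add: \<psi>_def)
  qed
  moreover have "\<psi> x = 0" if "r \<le> dist a x" for x
  proof -
    have "r\<^sup>2 \<le> (dist a x)\<^sup>2"
      using that assms by (intro power_mono) auto
    then show ?thesis by (simp add: \<psi>_def q_def)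
  qed
  ultimately show ?thesis
    using that[of "r / 2" \<psi>] assms by auto
qed

lemma C_space_scaleR:
  "\<lbrakk>open \<Omega>; C_upto n S \<Omega> \<psi>; f \<in> C_space n S \<Omega>\<rbrakk> \<Longrightarrow> (\<lambda>x. \<psi> x *\<^sub>R f x) \<in> C_space n S \<Omega>"
  by (auto simp: C_space_def intro: C_upto_scaleR)

lemma C_space_continuous: "\<lbrakk>f \<in> C_space n S \<Omega>; \<Omega> \<subseteq> S\<rbrakk> \<Longrightarrow> continuous_on \<Omega> f"
  by (auto simp: C_space_def intro: extends_to_imp_continuous C_upto_extends)

section \<open>Compatible topologies\<close>

abbreviation fun_scale :: "real \<Rightarrow> ('x \<Rightarrow> 'e::real_vector) \<Rightarrow> 'x \<Rightarrow> 'e" where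
  "fun_scale \<equiv> \<lambda>c f x. c *\<^sub>R f x"

lemma sum_fun_apply: "(\<Sum>j\<in>I. F j) x = (\<Sum>j\<in>I. F j x)"
  by (induction I rule: infinite_finite_induct) simp_all

lemma of_real_in_scalar_field: "K_banach_space K s \<Longrightarrow> of_real c \<in> K"
  using K_banach_space.scalar_field by fastforce

lemma frechet_imp_F_space:
  fixes X :: "('x \<Rightarrow> 'e::banach) topology"
  assumes K: "K_banach_space K s" and X: "frechet K s X"
  obtains d where "F_space fun_scale (topspace X) d" "Metric_space.mtopology (topspace X) d = X"
proof -
  interpret K_banach_space K s by fact
  obtain d where d: "Metric_space (topspace X) d" "Metric_space.mtopology (topspace X) d = X"
      "Metric_space.mcomplete (topspace X) d"
    and translation: "\<And>f g h. \<lbrakk>f \<in> topspace X; g \<in> topspace X; h \<in> topspace X\<rbrakk> \<Longrightarrow>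
       d (\<lambda>x. f x + h x) (\<lambda>x. g x + h x) = d f g"
    using X unfolding frechet_def by blast
  have zero: "(\<lambda>x. 0) \<in> topspace X"
    and add: "continuous_map (prod_topology X X) X (\<lambda>(f, g). (\<lambda>x. f x + g x))"
    and scale: "continuous_map (prod_topology (top_of_set K) X) X (\<lambda>(c, f). (\<lambda>x. s c (f x)))"
    using X unfolding frechet_def locally_convex_def topological_function_space_def by blast+
  note K_of_real = of_real_in_scalar_field[OF K]
  have scale_lim: "limitin X (\<lambda>k. fun_scale (c k) f) (fun_scale c0 f) sequentially"
    if "c \<longlonglongrightarrow> c0" "f \<in> topspace X" for c c0 f
  proof -
    have "limitin (top_of_set K) (\<lambda>k. of_real (c k)) (of_real c0) sequentially"
      using that(1) by (simp add: limitin_subtopology K_of_real tendsto_of_real)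
    then have "limitin (prod_topology (top_of_set K) X) (\<lambda>k. (of_real (c k), f)) (of_real c0, f) sequentially"
      using that(2) by (simp add: limitin_pairwise o_def)
    from continuous_map_limit[OF scale this] show ?thesis
      by (simp add: o_def scale_of_real)
  qed
  have scale_cont: "continuous_map X X (fun_scale c)" for c
  proof -
    have "continuous_map X (prod_topology (top_of_set K) X) (\<lambda>f. (of_real c, f))"
      by (intro continuous_map_pairedI) (simp_all add: K_of_real)
    from continuous_map_compose[OF this scale] show ?thesis
      by (simp add: o_def scale_of_real)
  qed
  interpret V: vector_space "fun_scale :: real \<Rightarrow> ('x \<Rightarrow> 'e) \<Rightarrow> 'x \<Rightarrow> 'e"
    by standard (simp_all add: fun_eq_iff algebra_simps)
  have "F_space fun_scale (topspace X) d"
  proof (intro F_space.intro F_space_axioms.intro)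
    show "vector_space (fun_scale :: real \<Rightarrow> ('x \<Rightarrow> 'e) \<Rightarrow> 'x \<Rightarrow> 'e)"
      by (rule V.vector_space_axioms)
    show "V.subspace (topspace X)"
    proof (rule V.subspaceI)
      show "f + g \<in> topspace X" if "f \<in> topspace X" "g \<in> topspace X" for f g
        using funcset_mem[OF continuous_map_funspace[OF add], of "(f, g)"] that
        by (simp add: plus_fun_def)
      show "fun_scale c f \<in> topspace X" if "f \<in> topspace X" for c f
        using funcset_mem[OF continuous_map_funspace[OF scale_cont] that] .
    qed (use zero in \<open>simp add: zero_fun_def\<close>)
    show "limitin (Metric_space.mtopology (topspace X) d) (\<lambda>k. fun_scale (1 / real (Suc k)) f) 0 sequentially"
      if "f \<in> topspace X" for f
    proof -
      have "(\<lambda>k. 1 / real (Suc k)) \<longlonglongrightarrow> 0"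
        using LIMSEQ_inverse_real_of_nat by (simp add: inverse_eq_divide)
      from scale_lim[OF this that] show ?thesis
        unfolding d(2) by (simp add: zero_fun_def)
    qed
    show "d (f + h) (g + h) = d f g" if "f \<in> topspace X" "g \<in> topspace X" "h \<in> topspace X" for f g h
      using translation[OF that] by (simp add: plus_fun_def)
  qed (use d scale_cont in simp_all)
  then show ?thesis
    using that d(2) by blast
qed

lemma compatible_topology_F_space:
  fixes X :: "('x \<Rightarrow> 'e::banach) topology"
  assumes "K_banach_space K s" "compatible_topology K s \<Omega> A X"
  obtains d where "F_space fun_scale A d" "Metric_space.mtopology A d = X"
  using frechet_imp_F_space[OF assms(1), of X] assms(2) unfolding compatible_topology_def by blast

text \<open>
  Compatibility speaks of null sequences; translation invariance extends it to all limits.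
\<close>
lemma compatible_topology_pointwise:
  fixes X :: "('x \<Rightarrow> 'e::banach) topology"
  assumes K: "K_banach_space K s" and X: "compatible_topology K s \<Omega> A X"
    and F: "\<And>k. F k \<in> A" "limitin X F f sequentially" and x: "x \<in> \<Omega>"
  shows "(\<lambda>k. F k x) \<longlonglongrightarrow> f x"
proof -
  obtain d where d: "F_space fun_scale A d" and mtop: "Metric_space.mtopology A d = X"
    using compatible_topology_F_space[OF K X] .
  interpret F_space fun_scale A d by (rule d)
  have "f \<in> A"
    using F(2) limitin_mspace by (simp flip: mtop)
  then have "range (\<lambda>k. F k - f) \<subseteq> A"
    using F(1) by auto
  moreover have "limitin X (\<lambda>k. F k - f) (\<lambda>x. 0) sequentially"
    using limitin_diff_0[of F f] F by (simp add: mtop zero_fun_def)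
  ultimately have "(\<lambda>k. (F k - f) x) \<longlonglongrightarrow> 0"
    using X x unfolding compatible_topology_def by blast
  then show ?thesis
    by (simp add: LIM_zero_iff)
qed

text \<open>
  Pointwise limits determine the limit in the topology, so a multiplication operator has a closed
  graph. This replaces any knowledge of how the topology treats products.
\<close>
lemma compatible_topology_continuous_multiplier:
  fixes X :: "('x \<Rightarrow> 'e::banach) topology"
  assumes K: "K_banach_space K s" and X: "compatible_topology K s \<Omega> A X"
    and supp: "\<And>f x. f \<in> A \<Longrightarrow> x \<notin> \<Omega> \<Longrightarrow> f x = 0"
    and mult: "\<And>f. f \<in> A \<Longrightarrow> (\<lambda>x. \<psi> x *\<^sub>R f x) \<in> A"
  shows "continuous_map X X (\<lambda>f x. \<psi> x *\<^sub>R f x)"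
proof -
  obtain d where d: "F_space fun_scale A d" and mtop: "Metric_space.mtopology A d = X"
    using compatible_topology_F_space[OF K X] .
  interpret F_space fun_scale A d by (rule d)
  interpret M: F_space_linear_map fun_scale A d fun_scale A d "\<lambda>f x. \<psi> x *\<^sub>R f x"
    by unfold_locales (simp_all add: mult fun_eq_iff algebra_simps)
  have "continuous_map mtopology mtopology (\<lambda>f x. \<psi> x *\<^sub>R f x)"
  proof (rule M.closed_graph)
    fix F g
    assume F: "\<And>k. F k \<in> A" "limitin mtopology F 0 sequentially"
      "limitin mtopology (\<lambda>k x. \<psi> x *\<^sub>R F k x) g sequentially"
    have "g x = 0" if "x \<in> \<Omega>" for x
    proof (rule LIMSEQ_unique)
      show "(\<lambda>k. \<psi> x *\<^sub>R F k x) \<longlonglongrightarrow> g x"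
        using compatible_topology_pointwise[OF K X mult[OF F(1)] F(3)[unfolded mtop] that] .
      show "(\<lambda>k. \<psi> x *\<^sub>R F k x) \<longlonglongrightarrow> 0"
        using tendsto_scaleR[OF tendsto_const[of "\<psi> x"]
            compatible_topology_pointwise[OF K X F(1) F(2)[unfolded mtop] that]] by simp
    qed
    moreover have "g \<in> A"
      using F(3) limitin_mspace by blast
    ultimately show "g = 0"
      using supp by (fastforce simp: fun_eq_iff)
  qed
  then show ?thesis
    by (simp add: mtop)
qed

section \<open>Continuity of biseparating maps\<close>

text \<open>
  The centres approach \<open>x0\<close> along a coordinate axis, at distance \<open>4 R j\<close> from it, where the radii
  \<open>R j\<close> are halved at each step.
\<close>
lemma disjoint_balls:
  fixes x0 :: "real^'p::finite"
  assumes "\<rho> > 0"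
  obtains a :: "nat \<Rightarrow> real^'p" and R :: "nat \<Rightarrow> real"
  where "\<And>j. R j > 0" "\<And>j. ball (a j) (R j) \<subseteq> ball x0 \<rho>"
    "\<And>i j. i \<noteq> j \<Longrightarrow> ball (a i) (R i) \<inter> ball (a j) (R j) = {}"
proof -
  define v :: "real^'p" where "v = axis undefined 1"
  define a where "a j = x0 + (\<rho> / 2 ^ (j + 1)) *\<^sub>R v" for j
  define R where "R j = \<rho> / 2 ^ (j + 3)" for j :: nat
  have v: "norm v = 1" by (simp add: v_def)
  have R: "R j > 0" for j using assms by (simp add: R_def)
  have a_R: "\<rho> / 2 ^ (j + 1) = 4 * R j" for j
    by (simp add: R_def power_add)
  have dist: "dist (a i) (a j) = \<bar>4 * R i - 4 * R j\<bar>" for i j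
    by (simp add: a_def dist_norm v flip: scaleR_left_diff_distrib) (simp add: R_def power_add)
  have R_step: "2 * R j \<le> R i" if "i < j" for i j
  proof -
    have "(2::real) ^ (i + 4) \<le> 2 ^ (j + 3)"
      using that by (intro power_increasing) auto
    then show ?thesis
      using assms by (simp add: R_def field_simps power_add)
  qed
  show ?thesis
  proof (rule that[OF R])
    show "ball (a j) (R j) \<subseteq> ball x0 \<rho>" for j
    proof -
      have "dist x0 (a j) = 4 * R j"
        using R[of j] by (simp add: a_def dist_norm v a_R[simplified])
      moreover have "\<rho> = 8 * 2 ^ j * R j"
        by (simp add: R_def power_add)
      moreover have "8 * R j \<le> 8 * 2 ^ j * R j"
        using R[of j] by simp
      ultimately have "dist x0 (a j) + R j \<le> \<rho>"
        using R[of j] by linarith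
      moreover have "dist x0 z \<le> dist x0 (a j) + dist (a j) z" for z
        by (rule dist_triangle)
      ultimately show ?thesis
        unfolding subset_iff mem_ball by (meson add_strict_left_mono order.strict_trans1 order.strict_trans2)
    qed
    have "ball (a i) (R i) \<inter> ball (a j) (R j) = {}" if "i < j" for i j
      using R_step[OF that] R[of i] R[of j] by (intro disjoint_ballI) (simp add: dist)
    then show "ball (a i) (R i) \<inter> ball (a j) (R j) = {}" if "i \<noteq> j" for i j
      using that by (metis Int_commute linorder_neq_iff)
  qed
qed

text \<open>
  Cut \<open>f\<close> off to a nonzero function \<open>w\<close> that lives in the ball. As \<open>w\<close> is not disjoint from \<open>f\<close> and the
  inverse of \<open>T\<close> is separating, \<open>T w\<close> and \<open>T f\<close> have a common nonzero at some \<open>y\<close>. A function that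
  vanishes on the ball is disjoint from \<open>w\<close>; as \<open>T\<close> is separating, its image vanishes where \<open>T w\<close>
  does not, in particular at \<open>y\<close>.
\<close>
lemma biseparating_point_over_ball:
  fixes \<Omega> :: "(real^'p::finite) set"
  assumes T: "biseparating \<Omega> (C_space n S \<Omega>) \<Omega>' A' T"
    and "open \<Omega>" and f: "f \<in> C_space n S \<Omega>"
    and ball: "r > 0" "ball a r \<subseteq> cozero \<Omega> f"
  obtains y where "y \<in> \<Omega>'" "T f y \<noteq> 0"
    and "\<And>h. \<lbrakk>h \<in> C_space n S \<Omega>; \<And>x. x \<in> ball a r \<Longrightarrow> h x = 0\<rbrakk> \<Longrightarrow> T h y = 0"
proof -
  let ?A = "C_space n S \<Omega>"
  obtain \<theta> :: "real^'p \<Rightarrow> real" and r' where \<theta>: "r' > 0" "C_upto n S \<Omega> \<theta>"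
    "\<And>x. dist a x < r' \<Longrightarrow> \<theta> x = 1" "\<And>x. r \<le> dist a x \<Longrightarrow> \<theta> x = 0"
    using bump_function[OF ball(1), of n a] \<open>open \<Omega>\<close> by metis
  define w where "w x = \<theta> x *\<^sub>R f x" for x
  have w: "w \<in> ?A"
    unfolding w_def[abs_def] by (rule C_space_scaleR[OF \<open>open \<Omega>\<close> \<theta>(2) f])
  have w_supp: "w x = 0" if "x \<notin> ball a r" for x
    using that \<theta>(4) by (simp add: w_def)
  have inv: "inv_into ?A T (T h) = h" if "h \<in> ?A" for h
    using T that by (simp add: biseparating_def bij_betw_def)
  have TA: "T h \<in> A'" if "h \<in> ?A" for h
    using T that by (auto simp: biseparating_def separating_def)
  have sep: "cozero \<Omega>' (T h) \<inter> cozero \<Omega>' (T h') = {}"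
    if "h \<in> ?A" "h' \<in> ?A" "cozero \<Omega> h \<inter> cozero \<Omega> h' = {}" for h h'
    using T that unfolding biseparating_def separating_def by blast
  have sep_inv: "cozero \<Omega> h \<inter> cozero \<Omega> h' = {}"
    if "h \<in> ?A" "h' \<in> ?A" "cozero \<Omega>' (T h) \<inter> cozero \<Omega>' (T h') = {}" for h h'
  proof -
    have "cozero \<Omega> (inv_into ?A T (T h)) \<inter> cozero \<Omega> (inv_into ?A T (T h')) = {}"
      using T TA[OF that(1)] TA[OF that(2)] that(3) unfolding biseparating_def separating_def by blast
    then show ?thesis by (simp add: inv that)
  qed
  have "a \<in> cozero \<Omega> w \<inter> cozero \<Omega> f"
    using ball \<theta>(1) \<theta>(3)[of a] by (auto simp: cozero_def w_def subset_iff)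
  then have "cozero \<Omega>' (T w) \<inter> cozero \<Omega>' (T f) \<noteq> {}"
    using sep_inv[OF w f] by blast
  then obtain y where y: "y \<in> \<Omega>'" "T w y \<noteq> 0" "T f y \<noteq> 0"
    by (auto simp: cozero_def)
  have "T h y = 0" if "h \<in> ?A" "\<And>x. x \<in> ball a r \<Longrightarrow> h x = 0" for h
  proof -
    have "cozero \<Omega> h \<inter> cozero \<Omega> w = {}"
      unfolding cozero_def using that(2) w_supp by blast
    from sep[OF that(1) w this] show ?thesis
      using y by (auto simp: cozero_def)
  qed
  then show ?thesis
    using that y by blast
qed

text \<open>
  The gliding hump argument, carried out for \<^const>\<open>C_space\<close>, of which \<^const>\<open>C_open\<close> and
  \<^const>\<open>C_closure\<close> are instances. It is run through the closed graph theorem: a nonzero limit \<open>g\<close>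
  over \<open>0\<close> yields a function whose image under \<open>T\<close> is unbounded on a compact ball.
\<close>
theorem biseparating_continuous:
  fixes \<Omega> \<Omega>' :: "(real^'p::finite) set"
    and X :: "(real^'p \<Rightarrow> 'e::banach) topology" and Y :: "(real^'p \<Rightarrow> 'f::banach) topology"
  assumes A_def: "A = C_space n S \<Omega>" and A'_def: "A' = C_space n S' \<Omega>'"
    and KE: "K_banach_space K sE" and KF: "K_banach_space K sF"
    and \<Omega>: "open \<Omega>" and \<Omega>': "open \<Omega>'" "\<Omega>' \<subseteq> S'" and \<Omega>S: "\<Omega> \<subseteq> S"
    and X: "compatible_topology K sE \<Omega> A X" and Y: "compatible_topology K sF \<Omega>' A' Y"
    and lin: "K_linear_on K sE sF A T" and T: "biseparating \<Omega> A \<Omega>' A' T"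
  shows "continuous_map X Y T"
proof -
  obtain d where d: "F_space fun_scale A d" and mtopX: "Metric_space.mtopology A d = X"
    using compatible_topology_F_space[OF KE X] .
  obtain d' where d': "F_space fun_scale A' d'" and mtopY: "Metric_space.mtopology A' d' = Y"
    using compatible_topology_F_space[OF KF Y] .
  interpret dom: F_space fun_scale A d by (rule d)
  interpret cod: F_space fun_scale A' d' by (rule d')
  have bij: "bij_betw T A A'"
    using T by (simp add: biseparating_def)
  interpret L: F_space_linear_map fun_scale A d fun_scale A' d' T
  proof unfold_locales
    show "T f \<in> A'" if "f \<in> A" for f
      using bij that by (rule bij_betw_apply)
    show "T (f + g) = T f + T g" if "f \<in> A" "g \<in> A" for f g
      using lin that unfolding K_linear_on_def plus_fun_def by blast
    show "T (fun_scale c f) = fun_scale c (T f)" if "f \<in> A" for c f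
    proof -
      have "T (\<lambda>x. sE (of_real c) (f x)) = (\<lambda>y. sF (of_real c) (T f y))"
        using lin that of_real_in_scalar_field[OF KE] unfolding K_linear_on_def by blast
      then show ?thesis
        by (simp add: K_banach_space.scale_of_real[OF KE] K_banach_space.scale_of_real[OF KF])
    qed
  qed
  have supp: "f x = 0" if "f \<in> A" "x \<notin> \<Omega>" for f x
    using that by (simp add: A_def C_space_def)
  have supp': "g y = 0" if "g \<in> A'" "y \<notin> \<Omega>'" for g y
    using that by (simp add: A'_def C_space_def)
  have cozero_open: "open (cozero \<Omega> f)" if "f \<in> A" for f
    using continuous_open_preimage[OF C_space_continuous[of f n S \<Omega>] \<Omega> open_Compl[OF closed_singleton]] that \<Omega>S
    by (simp add: A_def cozero_def vimage_def Int_def)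
  have cozero_open': "open (cozero \<Omega>' g)" if "g \<in> A'" for g
    using continuous_open_preimage[OF C_space_continuous[of g n S' \<Omega>'] \<Omega>'(1) open_Compl[OF closed_singleton]] that \<Omega>'(2)
    by (simp add: A'_def cozero_def vimage_def Int_def)
  have "continuous_map dom.mtopology cod.mtopology T"
  proof (rule L.closed_graph, rule ccontr)
    fix F g
    assume F: "\<And>k. F k \<in> A" "limitin dom.mtopology F 0 sequentially"
      and TF: "limitin cod.mtopology (\<lambda>k. T (F k)) g sequentially" and "g \<noteq> 0"
    have g: "g \<in> A'"
      using TF cod.limitin_mspace by blast
    obtain y0 where y0: "y0 \<in> cozero \<Omega>' g"
      using \<open>g \<noteq> 0\<close> supp'[OF g] by (auto simp: cozero_def fun_eq_iff)
    then obtain r where r: "r > 0" "cball y0 r \<subseteq> cozero \<Omega>' g"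
      using cozero_open'[OF g] open_contains_cball by blast
    obtain \<theta> :: "real^'p \<Rightarrow> real" and r0 where \<theta>: "r0 > 0" "C_upto n S' \<Omega>' \<theta>"
      "\<And>y. dist y0 y < r0 \<Longrightarrow> \<theta> y = 1" "\<And>y. r \<le> dist y0 y \<Longrightarrow> \<theta> y = 0"
      using bump_function[OF r(1), of n y0] \<Omega>'(1) by metis
    define u where "u y = \<theta> y *\<^sub>R g y" for y
    have u: "u \<in> A'"
      using C_space_scaleR[OF \<Omega>'(1) \<theta>(2)] g unfolding u_def[abs_def] A'_def by blast
    obtain f0 where f0: "f0 \<in> A" "T f0 = u"
      using u bij by (auto simp: bij_betw_def)
    have "u y0 \<noteq> 0"
      using \<theta>(1) \<theta>(3)[of y0] y0 by (simp add: u_def cozero_def)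
    then have "f0 \<noteq> 0"
      using f0 L.T_0 by auto
    then obtain x0 where "x0 \<in> cozero \<Omega> f0"
      using supp[OF f0(1)] by (auto simp: cozero_def fun_eq_iff)
    then obtain \<rho> where \<rho>: "\<rho> > 0" "ball x0 \<rho> \<subseteq> cozero \<Omega> f0"
      using cozero_open[OF f0(1)] open_contains_ball by blast
    obtain a :: "nat \<Rightarrow> real^'p" and R :: "nat \<Rightarrow> real"
      where R: "\<And>j. R j > 0" and sub: "\<And>j. ball (a j) (R j) \<subseteq> ball x0 \<rho>"
      and disj: "\<And>i j. i \<noteq> j \<Longrightarrow> ball (a i) (R i) \<inter> ball (a j) (R j) = {}"
      by (rule disjoint_balls[OF \<rho>(1), of x0]) (rule that; assumption)
    (* f is the j-th hump and y a point over the ball of radius r' around its centre *)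
    define good where "good j f y r' \<longleftrightarrow> f \<in> A \<and> d f 0 \<le> 1 / 2 ^ j \<and>
        (\<forall>x. x \<notin> ball (a j) (R j) \<longrightarrow> f x = 0) \<and>
        r' \<le> R j \<and> y \<in> cball y0 r \<and> real j < norm (T f y) \<and>
        (\<forall>h\<in>A. (\<forall>x\<in>ball (a j) r'. h x = 0) \<longrightarrow> T h y = 0)" for j f y r'
    have "\<exists>f y r'. good j f y r'" for j
    proof -
      obtain \<psi> :: "real^'p \<Rightarrow> real" and r'' where \<psi>: "r'' > 0" "C_upto n S \<Omega> \<psi>"
        "\<And>x. dist (a j) x < r'' \<Longrightarrow> \<psi> x = 1" "\<And>x. R j \<le> dist (a j) x \<Longrightarrow> \<psi> x = 0"
        using bump_function[OF R[of j], of n "a j"] \<Omega> by metis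
      define r' where "r' = min r'' (R j)"
      have r': "r' > 0" "r' \<le> R j" "\<And>x. x \<in> ball (a j) r' \<Longrightarrow> \<psi> x = 1"
        using \<psi> R by (auto simp: r'_def)
      have "ball (a j) r' \<subseteq> cozero \<Omega> f0"
        using subset_ball[OF r'(2), of "a j"] sub \<rho>(2) by blast
      then obtain y where y: "y \<in> \<Omega>'" "T f0 y \<noteq> 0"
        and local: "\<And>h. \<lbrakk>h \<in> A; \<And>x. x \<in> ball (a j) r' \<Longrightarrow> h x = 0\<rbrakk> \<Longrightarrow> T h y = 0"
        using biseparating_point_over_ball[OF T[unfolded A_def] \<Omega> f0(1)[unfolded A_def] r'(1)]
        unfolding A_def by metis
      have y_ball: "y \<in> cball y0 r"
        using y(2) \<theta>(4)[of y] by (cases "dist y0 y \<le> r") (auto simp: f0(2) u_def)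
      then have gy: "g y \<noteq> 0"
        using r(2) by (auto simp: cozero_def)
      (* scaling by c makes the value of the limit at y exceed j, with room to spare *)
      define c where "c = (real j + 1) / norm (g y)"
      define G where "G k = fun_scale c (\<lambda>x. \<psi> x *\<^sub>R F k x)" for k
      have mult: "(\<lambda>x. \<psi> x *\<^sub>R h x) \<in> A" if "h \<in> A" for h
        using C_space_scaleR[OF \<Omega> \<psi>(2)] that unfolding A_def by blast
      have G: "G k \<in> A" for k
        unfolding G_def by (intro dom.scale_in mult F(1))
      have "continuous_map X X (\<lambda>f x. \<psi> x *\<^sub>R f x)"
        by (rule compatible_topology_continuous_multiplier[OF KE X]) (fact supp, fact mult)
      then have "limitin X (\<lambda>k x. \<psi> x *\<^sub>R F k x) 0 sequentially"
        using continuous_map_limit[OF _ F(2)[unfolded mtopX], of X "\<lambda>f x. \<psi> x *\<^sub>R f x"]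
        by (simp add: o_def zero_fun_def)
      then have "limitin dom.mtopology G 0 sequentially"
        using continuous_map_limit[OF dom.continuous_scale[of c], of "\<lambda>k x. \<psi> x *\<^sub>R F k x" 0 sequentially]
        by (simp add: mtopX G_def[abs_def] o_def zero_fun_def)
      then have small: "\<forall>\<^sub>F k in sequentially. d (G k) 0 < 1 / 2 ^ j"
        unfolding dom.limitin_metric
        by (auto elim: eventually_mono dest!: spec[of _ "1 / 2 ^ j"])
      have "T (G k) y = c *\<^sub>R T (F k) y" for k
      proof -
        have "T ((\<lambda>x. \<psi> x *\<^sub>R F k x) - F k) y = 0"
          using r'(3) by (intro local dom.diff_in mult F(1)) simp
        then have "T (\<lambda>x. \<psi> x *\<^sub>R F k x) y = T (F k) y"
          using mult[OF F(1)] F(1) by (simp add: L.T_diff)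
        then show ?thesis
          unfolding G_def L.T_scale[OF mult[OF F(1)]] by simp
      qed
      moreover have "(\<lambda>k. T (F k) y) \<longlonglongrightarrow> g y"
        using compatible_topology_pointwise[OF KF Y _ TF[unfolded mtopY] y(1)] F(1) by simp
      ultimately have "(\<lambda>k. norm (T (G k) y)) \<longlonglongrightarrow> norm (c *\<^sub>R g y)"
        by (simp only:) (intro tendsto_intros)
      moreover have "norm (c *\<^sub>R g y) = real j + 1"
        using gy by (simp add: c_def)
      ultimately have "\<forall>\<^sub>F k in sequentially. real j < norm (T (G k) y)"
        by (intro order_tendstoD(1)) auto
      then obtain k where "d (G k) 0 < 1 / 2 ^ j" "real j < norm (T (G k) y)"
        using small eventually_happens'[OF sequentially_bot eventually_conj] by blast
      moreover have "\<forall>x. x \<notin> ball (a j) (R j) \<longrightarrow> G k x = 0"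
        using \<psi>(4) by (simp add: G_def)
      ultimately have "good j (G k) y r'"
        unfolding good_def using G[of k] r'(2) y_ball by (intro conjI ballI impI local) simp_all
      then show ?thesis by blast
    qed
    then obtain f y r' where "\<And>j. good j (f j) (y j) (r' j)"
      by metis
    then have f: "\<And>j. f j \<in> A" "\<And>j. d (f j) 0 \<le> 1 / 2 ^ j"
      and f_supp: "\<And>j x. x \<notin> ball (a j) (R j) \<Longrightarrow> f j x = 0"
      and r': "\<And>j. r' j \<le> R j"
      and y: "\<And>j. y j \<in> cball y0 r" "\<And>j. real j < norm (T (f j) (y j))"
      and local: "\<And>j h. \<lbrakk>h \<in> A; \<And>x. x \<in> ball (a j) (r' j) \<Longrightarrow> h x = 0\<rbrakk> \<Longrightarrow> T h (y j) = 0"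
      unfolding good_def by blast+
    obtain s where s: "limitin dom.mtopology (\<lambda>m. \<Sum>j<m. f j) s sequentially"
      using dom.geometric_series_converges[OF f] by blast
    have sA: "s \<in> A"
      using s dom.limitin_mspace by blast
    have s_eq: "s x = f j x" if x: "x \<in> ball (a j) (R j)" for x j
    proof (rule LIMSEQ_unique)
      have "x \<in> \<Omega>"
        using x sub[of j] \<rho>(2) by (auto simp: cozero_def)
      then show "(\<lambda>m. (\<Sum>i<m. f i) x) \<longlonglongrightarrow> s x"
        using compatible_topology_pointwise[OF KE X _ s[unfolded mtopX]] f(1) by simp
      have "f i x = 0" if "i \<noteq> j" for i
        using f_supp disj[OF that] x by blast
      then have "(\<Sum>i<m. f i) x = f j x" if "m > j" for m
        using that sum.remove[of "{..<m}" j "\<lambda>i. f i x"] by (simp add: sum_fun_apply)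
      then show "(\<lambda>m. (\<Sum>i<m. f i) x) \<longlonglongrightarrow> f j x"
        by (intro tendsto_eventually) (auto simp: eventually_sequentially intro!: exI[of _ "Suc j"])
    qed
    have "T s (y j) = T (f j) (y j)" for j
    proof -
      have "T (s - f j) (y j) = 0"
        using s_eq[of _ j] subset_ball[OF r'[of j], of "a j"] sA f(1)
        by (intro local) auto
      then show ?thesis
        using sA f(1) by (simp add: L.T_diff)
    qed
    then have large: "real j < norm (T s (y j))" for j
      using y(2)[of j] by simp
    have "continuous_on (cball y0 r) (T s)"
      using C_space_continuous[OF _ \<Omega>'(2), of "T s" n] L.T_in[OF sA] r(2)
      by (auto simp: A'_def cozero_def intro: continuous_on_subset)
    then have "bounded (T s ` cball y0 r)"
      by (intro compact_imp_bounded compact_continuous_image compact_cball)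
    then obtain B where B: "\<And>z. z \<in> cball y0 r \<Longrightarrow> norm (T s z) \<le> B"
      unfolding bounded_iff by blast
    obtain j where "B < real j"
      using reals_Archimedean2 by blast
    then show False
      using large[of j] B[OF y(1)[of j]] by simp
  qed
  then show ?thesis
    by (simp add: mtopX mtopY)
qed

theorem theorem4p1:
  fixes K :: "complex set"
    and sE :: "complex \<Rightarrow> 'e::banach \<Rightarrow> 'e"
    and sF :: "complex \<Rightarrow> 'f::banach \<Rightarrow> 'f"
    and n :: nat
    and \<Omega> \<Omega>' :: "(real^'p::finite) set"
    and A :: "(real^'p \<Rightarrow> 'e) set"
    and A' :: "(real^'p \<Rightarrow> 'f) set"
    and X :: "(real^'p \<Rightarrow> 'e) topology"
    and Y :: "(real^'p \<Rightarrow> 'f) topology"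
    and T :: "(real^'p \<Rightarrow> 'e) \<Rightarrow> (real^'p \<Rightarrow> 'f)"
  assumes "K_banach_space K sE" and "K_banach_space K sF"
    and "n \<ge> 1"
    and "open \<Omega>" and "\<Omega> \<noteq> {}" and "open \<Omega>'"
    and "(A = C_open n \<Omega> \<and> A' = C_open n \<Omega>') \<or>
         (bounded \<Omega> \<and> bounded \<Omega>' \<and> A = C_closure n \<Omega> \<and> A' = C_closure n \<Omega>')"
    and "compatible_topology K sE \<Omega> A X"
    and "compatible_topology K sF \<Omega>' A' Y"
    and "K_linear_on K sE sF A T"
    and "biseparating \<Omega> A \<Omega>' A' T"
  shows "continuous_map X Y T"
proof -
  obtain S S' where S: "\<Omega> \<subseteq> S" "\<Omega>' \<subseteq> S'" and A: "A = C_space n S \<Omega>" "A' = C_space n S' \<Omega>'"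
    using assms(7) closure_subset[of \<Omega>] closure_subset[of \<Omega>'] unfolding C_open_eq C_closure_eq by blast
  show ?thesis
    using biseparating_continuous[OF A assms(1,2,4,6) S(2,1) assms(8-11)] .
qed

end
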